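(* Let $k\ge 0$ be an integer, let $\varepsilon(x,\xi),\rho(x,\xi)\in C^k(\mathbb{S}D)$ with $\varepsilon(x,\xi)\ge 0$, and put $\alpha=\varepsilon+\mathrm{i}\rho$. Let a (complex-valued) function $\varphi(x,\xi)\in C^{k+1}(\mathbb{S}D)$ be a solution of the equation $$\frac{1}{k!}\big(\mathcal{H}+\alpha\big)^{k+1}\varphi=0$$ in $\mathbb{S}D$ and satisfy the boundary conditions $$\varphi(x,\xi)=(\mathcal{H}\varphi)(x,\xi)=\dots=(\mathcal{H}^k\varphi)(x,\xi)=0\qquad\text{for } x\in\partial D,\ \langle n_x,\xi\rangle<0 ,$$ where $n_x$ is the outer normal to the surface $\partial D$ at the point $x$. Then $\varphi(x,\xi)\equiv 0$ for $(x,\xi)\in\mathbb{S}D$.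
   Context: $D\subset\mathbb{R}^3$ is a bounded convex domain with smooth boundary $\partial D$, $\mathbb{S}^2$ is the unit sphere of $\mathbb{R}^3$, and $\mathbb{S}D=\{(x,\xi): x\in D,\ \xi\in\mathbb{S}^2\}$. The functions $\varepsilon,\rho$ are real-valued and bounded. Functions of class $C^j(\mathbb{S}D)$ are understood to have their derivatives up to order $j$ continuous up to the boundary, so that the values on $x\in\partial D$ are defined. The operator $\mathcal{H}$ is $(\mathcal{H}\psi)(x,\xi)=\frac{d}{d\tau}\psi(x+\tau\xi,\xi)\big|_{\tau=0}=\sum_{j=1}^3\xi^j\frac{\partial\psi}{\partial x^j}(x,\xi)$; $\mathcal{H}^j$ denotes its $j$-th power, and $\mathcal{H}+\alpha$ is the operator $\psi\mapsto\mathcal{H}\psi+\alpha\psi$. *)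

theory Defs
  imports "HOL-Analysis.Analysis"
begin

(* C^k functions on an open set U, with all partial derivatives up to order k
   extending continuously to a set V with U \<subseteq> V \<subseteq> closure U.
   Taking V = U gives the usual class C^k(U). The partial derivatives are the
   Frechet derivative applied to the standard basis vectors; requiring Frechet
   differentiability loses nothing, since the partial derivatives are required
   to be continuous. *)
primrec Ck_up_to ::
    "nat \<Rightarrow> 'a::euclidean_space set \<Rightarrow> 'a set \<Rightarrow> ('a \<Rightarrow> 'b::real_normed_vector) \<Rightarrow> bool" where
  "Ck_up_to 0 U V f \<longleftrightarrow> (\<exists>g. continuous_on V g \<and> (\<forall>p\<in>U. g p = f p))"
| "Ck_up_to (Suc k) U V f \<longleftrightarrow>
     (\<exists>g. continuous_on V g \<and> (\<forall>p\<in>U. g p = f p)) \<and>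
     (\<forall>p\<in>U. f differentiable (at p)) \<and>
     (\<forall>b\<in>Basis. Ck_up_to k U V (\<lambda>p. frechet_derivative f (at p) b))"

definition smooth_on :: "'a::euclidean_space set \<Rightarrow> ('a \<Rightarrow> real) \<Rightarrow> bool" where
  "smooth_on U r \<longleftrightarrow> (\<forall>k. Ck_up_to k U U r)"

definition local_defining_function ::
    "'a::euclidean_space set \<Rightarrow> 'a \<Rightarrow> 'a set \<Rightarrow> ('a \<Rightarrow> real) \<Rightarrow> bool" where
  "local_defining_function D x U r \<longleftrightarrow>
     open U \<and> x \<in> U \<and> smooth_on U r \<and>
     D \<inter> U = {y \<in> U. r y < 0} \<and>
     frontier D \<inter> U = {y \<in> U. r y = 0} \<and>
     (\<forall>y \<in> frontier D \<inter> U. frechet_derivative r (at y) \<noteq> (\<lambda>h. 0))"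

definition smooth_boundary :: "'a::euclidean_space set \<Rightarrow> bool" where
  "smooth_boundary D \<longleftrightarrow> (\<forall>x \<in> frontier D. \<exists>U r. local_defining_function D x U r)"

(* r is negative inside D, so its gradient points outwards; sgn normalises it.
   The resulting n does not depend on the choice of r. *)
definition outer_normal :: "'a::euclidean_space set \<Rightarrow> 'a \<Rightarrow> 'a \<Rightarrow> bool" where
  "outer_normal D x n \<longleftrightarrow>
     (\<exists>U r g. local_defining_function D x U r \<and> GDERIV r x :> g \<and> n = sgn g)"

definition SD :: "'a::euclidean_space set \<Rightarrow> ('a \<times> 'a) set" where
  "SD D = D \<times> sphere 0 1"

(* The class C^k(SD), with derivatives continuous up to the boundary. A function
   on the manifold D \<times> sphere 0 1 is C^k iff its extension to D \<times> (UNIV - {0}),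
   homogeneous of degree 0 in the second variable, is C^k; sgn y = y / |y|.
   Only the values of f on SD D matter. *)
definition Ck_SD ::
    "nat \<Rightarrow> 'a::euclidean_space set \<Rightarrow> ('a \<times> 'a \<Rightarrow> 'b::real_normed_vector) \<Rightarrow> bool" where
  "Ck_SD k D f \<longleftrightarrow>
     Ck_up_to k (D \<times> (UNIV - {0})) (closure D \<times> (UNIV - {0})) (\<lambda>(x, y). f (x, sgn y))"

definition H_op :: "('a::real_normed_vector \<times> 'a \<Rightarrow> complex) \<Rightarrow> 'a \<times> 'a \<Rightarrow> complex" where
  "H_op \<psi> = (\<lambda>(x, \<xi>). vector_derivative (\<lambda>\<tau>. \<psi> (x + \<tau> *\<^sub>R \<xi>, \<xi>)) (at 0))"

definition H_plus ::
    "('a::real_normed_vector \<times> 'a \<Rightarrow> complex) \<Rightarrow> ('a \<times> 'a \<Rightarrow> complex) \<Rightarrow> 'a \<times> 'a \<Rightarrow> complex" where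
  "H_plus \<alpha> \<psi> = (\<lambda>p. H_op \<psi> p + \<alpha> p * \<psi> p)"

(* A function on SD D takes the value c at a point p over the boundary of D,
   in the sense of continuous extension from SD D. *)
definition has_boundary_value ::
    "'a::euclidean_space set \<Rightarrow> ('a \<times> 'a \<Rightarrow> complex) \<Rightarrow> 'a \<times> 'a \<Rightarrow> complex \<Rightarrow> bool" where
  "has_boundary_value D \<psi> p c \<longleftrightarrow> (\<psi> \<longlongrightarrow> c) (at p within SD D)"

end

theory Submission
  imports Defs
begin

text \<open>
  The operator \<open>\<H> = H_op\<close> differentiates along straight lines and leaves the direction
  alone, so the problem splits into ordinary differential equations, one for each chord of \<open>D\<close>.
  Fix \<open>x \<in> D\<close> and a unit vector \<open>\<xi>\<close>, and let \<open>a < 0\<close> be the parameter at which the line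
  \<open>t \<mapsto> x + t\<xi>\<close> enters \<open>D\<close>. Write \<open>f(t) = \<phi>(x + t\<xi>, \<xi>)\<close> and \<open>A(t) = \<alpha>(x + t\<xi>, \<xi>)\<close>. The
  equation becomes \<open>L\<^sup>k\<^sup>+\<^sup>1 f = 0\<close> for \<open>L g = g' + A g\<close>.

  By convexity the entry is transversal: the whole of \<open>D\<close>, including a ball around \<open>x\<close>, lies on
  the inner side of the tangent plane at the entry point, hence the outer normal there has
  negative product with \<open>\<xi>\<close> (\<open>outer_normal_inner_neg\<close>). The boundary conditions therefore say that
  \<open>f, f', \<dots>, f\<^sup>(\<^sup>k\<^sup>)\<close> tend to \<open>0\<close> at \<open>a\<close>. As \<open>A\<close> has bounded derivatives, the product rule
  carries this over to \<open>f, L f, \<dots>, L\<^sup>k f\<close> (\<open>flat_at_first_order_op\<close>).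

  It remains to invert \<open>L\<close> one factor at a time. If \<open>L g = 0\<close> then
  \<open>(|g|\<^sup>2)' = - 2 Re A |g|\<^sup>2 \<le> 0\<close>, because \<open>Re A = \<epsilon> \<ge> 0\<close>; a nonnegative nonincreasing
  function with limit \<open>0\<close> at the left end vanishes (\<open>first_order_op_unique\<close>). Applied to
  \<open>L\<^sup>k f, \<dots>, L f, f\<close> in turn, this gives \<open>f = 0\<close>, in particular \<open>\<phi>(x, \<xi>) = f(0) = 0\<close>.
\<close>

section \<open>Functions of one variable with bounded or vanishing derivatives\<close>

abbreviation vderiv :: "(real \<Rightarrow> 'b::real_normed_vector) \<Rightarrow> real \<Rightarrow> 'b" where
  "vderiv g \<equiv> (\<lambda>t. vector_derivative g (at t))"

primrec bounded_derivs ::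
    "nat \<Rightarrow> real set \<Rightarrow> (real \<Rightarrow> 'b::real_normed_vector) \<Rightarrow> bool" where
  "bounded_derivs 0 I g \<longleftrightarrow> bounded (g ` I)"
| "bounded_derivs (Suc m) I g \<longleftrightarrow>
     bounded (g ` I) \<and> (\<forall>t\<in>I. g differentiable (at t)) \<and> bounded_derivs m I (vderiv g)"

text \<open>The number \<open>m\<close> counts the derivatives that tend to zero, from order \<open>0\<close> to
  order \<open>m - 1\<close>; each of these is itself differentiable, so that a first order operator can be
  applied \<open>m\<close> times.\<close>

primrec flat_at ::
    "nat \<Rightarrow> real \<Rightarrow> real \<Rightarrow> (real \<Rightarrow> 'b::real_normed_vector) \<Rightarrow> bool" where
  "flat_at 0 a b g \<longleftrightarrow> True"
| "flat_at (Suc m) a b g \<longleftrightarrow>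
     (g \<longlongrightarrow> 0) (at_right a) \<and> (\<forall>t\<in>{a<..<b}. g differentiable (at t)) \<and> flat_at m a b (vderiv g)"

lemma has_vderiv:
  "g differentiable (at t) \<Longrightarrow> (g has_vector_derivative vderiv g t) (at t)"
  for g :: "real \<Rightarrow> 'b::real_normed_vector"
  by (simp add: vector_derivative_works)

lemma differentiable_cong_on_open:
  fixes g h :: "real \<Rightarrow> 'b::real_normed_vector"
  assumes "open I" "t \<in> I" "\<And>s. s \<in> I \<Longrightarrow> g s = h s" and "g differentiable (at t)"
  shows "h differentiable (at t)" and "vderiv h t = vderiv g t"
proof -
  have "(h has_vector_derivative vderiv g t) (at t)"
    by (rule has_vector_derivative_transform_within_open[OF has_vderiv[OF assms(4)] assms(1,2)])
       (rule assms(3))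
  then show "h differentiable (at t)" "vderiv h t = vderiv g t"
    by (auto intro: differentiableI_vector vector_derivative_at)
qed

lemma bounded_derivs_cong:
  assumes "open I" "\<And>t. t \<in> I \<Longrightarrow> g t = h t" "bounded_derivs m I g"
  shows "bounded_derivs m I h"
  using assms(2,3)
proof (induction m arbitrary: g h)
  case 0
  then show ?case by (metis bounded_derivs.simps(1) image_cong)
next
  case (Suc m)
  have 1: "bounded (h ` I)"
    using Suc.prems by (metis bounded_derivs.simps(2) image_cong)
  have 2: "h differentiable (at t)" "vderiv g t = vderiv h t" if "t \<in> I" for t
    using differentiable_cong_on_open[OF assms(1) that, of g h] Suc.prems that by auto
  have "bounded_derivs m I (vderiv h)"
    by (rule Suc.IH[of "vderiv g"]) (use 2 Suc.prems in auto)
  with 1 2 show ?case by simp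
qed

lemma bounded_derivs_add:
  assumes "open I" "bounded_derivs m I g" "bounded_derivs m I h"
  shows "bounded_derivs m I (\<lambda>t. g t + h t)"
  using assms(2,3)
proof (induction m arbitrary: g h)
  case 0
  then show ?case by (simp add: bounded_plus_comp)
next
  case (Suc m)
  have "bounded_derivs m I (vderiv (\<lambda>t. g t + h t))"
  proof (rule bounded_derivs_cong[OF assms(1), of "\<lambda>t. vderiv g t + vderiv h t"])
    fix t assume "t \<in> I"
    then show "vderiv g t + vderiv h t = vderiv (\<lambda>t. g t + h t) t"
      using Suc.prems
      by (intro vector_derivative_at[symmetric] has_vector_derivative_add has_vderiv) auto
  qed (use Suc in auto)
  then show ?case using Suc.prems by (auto simp: bounded_plus_comp)
qed

lemma bounded_derivs_bounded_linear:
  assumes "open I" "bounded_linear l" "bounded_derivs m I g"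
  shows "bounded_derivs m I (\<lambda>t. l (g t))"
  using assms(3)
proof (induction m arbitrary: g)
  case 0
  then show ?case using bounded_linear_image[OF _ assms(2), of "g ` I"] by (simp add: image_image)
next
  case (Suc m)
  have d: "((\<lambda>t. l (g t)) has_vector_derivative l (vderiv g t)) (at t)" if "t \<in> I" for t
    using bounded_linear.has_vector_derivative[OF assms(2) has_vderiv] Suc.prems that by auto
  have "bounded_derivs m I (vderiv (\<lambda>t. l (g t)))"
  proof (rule bounded_derivs_cong[OF assms(1), of "\<lambda>t. l (vderiv g t)"])
    fix t assume "t \<in> I"
    then show "l (vderiv g t) = vderiv (\<lambda>t. l (g t)) t"
      using vector_derivative_at[OF d] by simp
  qed (use Suc in auto)
  moreover have "bounded ((\<lambda>t. l (g t)) ` I)"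
    using bounded_linear_image[OF _ assms(2), of "g ` I"] Suc.prems by (auto simp: image_image)
  ultimately show ?case using differentiableI_vector[OF d] by auto
qed

lemma bounded_derivs_zero: "bounded_derivs m I (\<lambda>t. 0)"
  by (induction m) (auto simp: image_constant_conv)

lemma bounded_derivs_sum:
  assumes "open I" "\<And>i. i \<in> S \<Longrightarrow> bounded_derivs m I (g i)"
  shows "bounded_derivs m I (\<lambda>t. \<Sum>i\<in>S. g i t)"
  using assms(2)
  by (induction S rule: infinite_finite_induct)
     (auto simp: bounded_derivs_zero intro!: bounded_derivs_add[OF assms(1)])

lemma bounded_derivs_mono:
  "m \<le> m' \<Longrightarrow> bounded_derivs m' I g \<Longrightarrow> bounded_derivs m I g"
proof (induction m' arbitrary: m g)
  case (Suc m')
  show ?case using Suc.prems by (cases m) (auto intro: Suc.IH)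
qed auto

lemma flat_at_cong:
  assumes "a < b" "\<And>t. t \<in> {a<..<b} \<Longrightarrow> g t = h t" "flat_at m a b g"
  shows "flat_at m a b h"
  using assms(2,3)
proof (induction m arbitrary: g h)
  case 0
  then show ?case by simp
next
  case (Suc m)
  have "eventually (\<lambda>t. g t = h t) (at_right a)"
    using eventually_at_right_real[OF assms(1)] by eventually_elim (rule Suc.prems)
  then have 1: "(h \<longlongrightarrow> 0) (at_right a)"
    using Suc.prems(2) tendsto_cong[of g h "at_right a" 0] by simp
  have 2: "h differentiable (at t)" "vderiv g t = vderiv h t" if "t \<in> {a<..<b}" for t
    using differentiable_cong_on_open[OF open_greaterThanLessThan that, of g h] Suc.prems that
    by auto
  have "flat_at m a b (vderiv h)"
    by (rule Suc.IH[of "vderiv g"]) (use 2 Suc.prems in auto)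
  with 1 2 show ?case by simp
qed

lemma flat_at_SucD: "flat_at (Suc m) a b g \<Longrightarrow> flat_at m a b g"
  by (induction m arbitrary: g) auto

lemma flat_at_add:
  assumes "a < b" "flat_at m a b g" "flat_at m a b h"
  shows "flat_at m a b (\<lambda>t. g t + h t)"
  using assms(2,3)
proof (induction m arbitrary: g h)
  case 0
  then show ?case by simp
next
  case (Suc m)
  have "flat_at m a b (vderiv (\<lambda>t. g t + h t))"
  proof (rule flat_at_cong[OF assms(1), of "\<lambda>t. vderiv g t + vderiv h t"])
    fix t assume "t \<in> {a<..<b}"
    then show "vderiv g t + vderiv h t = vderiv (\<lambda>t. g t + h t) t"
      using Suc.prems
      by (intro vector_derivative_at[symmetric] has_vector_derivative_add has_vderiv) auto
  qed (use Suc in auto)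
  then show ?case using Suc.prems by (auto intro: tendsto_add_zero)
qed

lemma flat_at_mult:
  fixes A g :: "real \<Rightarrow> 'b::real_normed_algebra"
  assumes "a < b" "bounded_derivs m {a<..<b} A" "flat_at m a b g"
  shows "flat_at m a b (\<lambda>t. A t * g t)"
  using assms(2,3)
proof (induction m arbitrary: A g)
  case 0
  then show ?case by simp
next
  case (Suc m)
  have A: "bounded (A ` {a<..<b})" "bounded_derivs m {a<..<b} A"
    "bounded_derivs m {a<..<b} (vderiv A)"
    using Suc.prems(1) bounded_derivs_mono[OF _ Suc.prems(1), of m] by simp_all
  have d: "((\<lambda>t. A t * g t) has_vector_derivative A t * vderiv g t + vderiv A t * g t) (at t)"
    if "t \<in> {a<..<b}" for t
    using Suc.prems that by (intro has_vector_derivative_mult has_vderiv) auto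
  have "flat_at m a b (vderiv (\<lambda>t. A t * g t))"
  proof (rule flat_at_cong[OF assms(1), of "\<lambda>t. A t * vderiv g t + vderiv A t * g t"])
    show "A t * vderiv g t + vderiv A t * g t = vderiv (\<lambda>t. A t * g t) t"
      if "t \<in> {a<..<b}" for t
      using vector_derivative_at[OF d[OF that]] by simp
    show "flat_at m a b (\<lambda>t. A t * vderiv g t + vderiv A t * g t)"
      using Suc.IH[of A "vderiv g"] Suc.IH[of "vderiv A" g] A Suc.prems(2)
        flat_at_SucD[OF Suc.prems(2)]
      by (intro flat_at_add[OF assms(1)]) simp_all
  qed
  moreover obtain K where K: "norm (A t) \<le> K" if "t \<in> {a<..<b}" for t
    using A(1) unfolding bounded_iff by blast
  have "((\<lambda>t. A t * g t) \<longlongrightarrow> 0) (at_right a)"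
  proof (rule Lim_null_comparison)
    show "\<forall>\<^sub>F t in at_right a. norm (A t * g t) \<le> K * norm (g t)"
      using eventually_at_right_real[OF assms(1)]
      by eventually_elim
         (metis K norm_mult_ineq mult_right_mono norm_ge_zero order_trans)
    show "((\<lambda>t. K * norm (g t)) \<longlongrightarrow> 0) (at_right a)"
      using Suc.prems(2) by (auto intro: tendsto_mult_right_zero tendsto_norm_zero)
  qed
  ultimately show ?case using differentiableI_vector[OF d] by auto
qed

text \<open>For a function with bounded derivatives, flatness is only a matter of the
  limits of its iterated derivatives, which is what boundary conditions provide.\<close>

lemma flat_atI:
  assumes "bounded_derivs m {a<..<b} g"
    and "\<And>j. j < m \<Longrightarrow> ((vderiv ^^ j) g \<longlongrightarrow> 0) (at_right a)"
  shows "flat_at m a b g"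
  using assms
proof (induction m arbitrary: g)
  case 0
  then show ?case by simp
next
  case (Suc m)
  have "((vderiv ^^ j) (vderiv g) \<longlongrightarrow> 0) (at_right a)" if "j < m" for j
    using Suc.prems(2)[of "Suc j"] that by (simp add: funpow_Suc_right del: funpow.simps)
  then show ?case using Suc.IH[of "vderiv g"] Suc.prems(1) Suc.prems(2)[of 0] by auto
qed

section \<open>The first order operator on an interval\<close>

definition first_order_op :: "(real \<Rightarrow> complex) \<Rightarrow> (real \<Rightarrow> complex) \<Rightarrow> real \<Rightarrow> complex" where
  "first_order_op A g = (\<lambda>t. vderiv g t + A t * g t)"

text \<open>The term \<open>g'\<close> costs one order of flatness. Since \<open>A g\<close> is asked for the same lower order,
  a coefficient one degree less regular than \<open>g\<close> suffices, as for \<open>\<alpha> \<in> C\<^sup>k\<close> and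
  \<open>\<phi> \<in> C\<^sup>k\<^sup>+\<^sup>1\<close>.\<close>

lemma flat_at_first_order_op:
  assumes "a < b" "bounded_derivs m {a<..<b} A" "flat_at (Suc m) a b g"
  shows "flat_at m a b (first_order_op A g)"
  unfolding first_order_op_def
  using assms(3) flat_at_SucD[OF assms(3)]
  by (intro flat_at_add[OF assms(1)] flat_at_mult[OF assms(1,2)]) simp_all

lemma flat_at_funpow_first_order_op:
  assumes "a < b" "bounded_derivs k {a<..<b} A" "flat_at (Suc k) a b f" "j \<le> k"
  shows "flat_at (Suc k - j) a b ((first_order_op A ^^ j) f)"
  using assms(4)
proof (induction j)
  case 0
  then show ?case using assms(3) by simp
next
  case (Suc j)
  then have "flat_at (Suc (k - j)) a b ((first_order_op A ^^ j) f)"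
    by (simp add: Suc_diff_le)
  then show ?case
    using flat_at_first_order_op[OF assms(1) bounded_derivs_mono[OF _ assms(2)]] by simp
qed

text \<open>An energy argument: \<open>|g|\<^sup>2\<close> is nonincreasing since absorption, \<open>Re A \<ge> 0\<close>, cannot
  create energy, and it starts from \<open>0\<close>.\<close>

lemma first_order_op_unique:
  assumes "a < b" "\<And>t. t \<in> {a<..<b} \<Longrightarrow> Re (A t) \<ge> 0"
    and "\<And>t. t \<in> {a<..<b} \<Longrightarrow> g differentiable (at t)"
    and "(g \<longlongrightarrow> 0) (at_right a)"
    and "\<And>t. t \<in> {a<..<b} \<Longrightarrow> first_order_op A g t = 0"
    and t: "t \<in> {a<..<b}"
  shows "g t = 0"
proof -
  let ?N = "\<lambda>t. g t \<bullet> g t"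
  have d: "(?N has_real_derivative (- 2 * Re (A s) * ?N s)) (at s)" if s: "s \<in> {a<..<b}" for s
  proof -
    have g: "(g has_vector_derivative - A s * g s) (at s)"
      using has_vderiv[OF assms(3)[OF s]] assms(5)[OF s]
      by (simp add: first_order_op_def add_eq_0_iff2)
    have "(?N has_derivative (\<lambda>h. g s \<bullet> (h *\<^sub>R (- A s * g s)) + (h *\<^sub>R (- A s * g s)) \<bullet> g s)) (at s)"
      using g unfolding has_vector_derivative_def by (intro has_derivative_inner)
    moreover have "(\<lambda>h. g s \<bullet> (h *\<^sub>R (- A s * g s)) + (h *\<^sub>R (- A s * g s)) \<bullet> g s)
        = (*) (- 2 * Re (A s) * ?N s)"
      by (auto simp: fun_eq_iff inner_complex_def algebra_simps)
    ultimately show ?thesis by (simp add: has_field_derivative_def)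
  qed
  have le: "?N t \<le> ?N s" if s: "a < s" "s < t" for s
  proof (rule DERIV_nonpos_imp_nonincreasing[of s t ?N])
    show "s \<le> t" using s by simp
    fix x assume "s \<le> x" "x \<le> t"
    then have x: "x \<in> {a<..<b}" using s t by auto
    have "- 2 * Re (A x) * ?N x \<le> 0"
      using assms(2)[OF x] by (simp add: mult_nonneg_nonneg)
    with d[OF x] show "\<exists>y. (?N has_real_derivative y) (at x) \<and> y \<le> 0" by blast
  qed
  have "(?N \<longlongrightarrow> 0) (at_right a)"
    using tendsto_inner[OF assms(4) assms(4)] by simp
  moreover have "eventually (\<lambda>s. ?N t \<le> ?N s) (at_right a)"
    using eventually_at_right_real[of a t] t by (auto elim!: eventually_mono intro: le)
  ultimately have "?N t \<le> 0"
    by (intro tendsto_lowerbound[of ?N 0 "at_right a"]) auto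
  then show ?thesis by (metis inner_eq_zero_iff inner_ge_zero order_antisym)
qed

lemma funpow_first_order_op_unique:
  assumes "a < b" "\<And>t. t \<in> {a<..<b} \<Longrightarrow> Re (A t) \<ge> 0"
    and "bounded_derivs k {a<..<b} A" "flat_at (Suc k) a b f"
    and "\<And>t. t \<in> {a<..<b} \<Longrightarrow> (first_order_op A ^^ Suc k) f t = 0"
    and "t \<in> {a<..<b}"
  shows "f t = 0"
proof -
  \<comment> \<open>Strip the factors from the outside: \<open>i\<close> counts those already removed.\<close>
  have "\<forall>t\<in>{a<..<b}. (first_order_op A ^^ (Suc k - i)) f t = 0" if "i \<le> Suc k" for i
    using that
  proof (induction i)
    case 0
    then show ?case using assms(5) by simp
  next
    case (Suc i)
    then have i: "Suc k - i = Suc (k - i)" by simp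
    let ?g = "(first_order_op A ^^ (k - i)) f"
    have "Suc k - (k - i) = Suc i" using Suc.prems by simp
    then have "flat_at (Suc i) a b ?g"
      using flat_at_funpow_first_order_op[OF assms(1,3,4), of "k - i"] by simp
    moreover have "first_order_op A ?g t = 0" if "t \<in> {a<..<b}" for t
      using Suc that i by auto
    ultimately show ?case
      using first_order_op_unique[OF assms(1,2), where g = ?g] by auto
  qed
  from this[of "Suc k"] show ?thesis using assms(6) by simp
qed

section \<open>Restriction to lines\<close>

lemma has_vector_derivative_translate_iff:
  "((\<lambda>s. g (t + s)) has_vector_derivative d) (at 0) \<longleftrightarrow> (g has_vector_derivative d) (at t)"
  for g :: "real \<Rightarrow> 'b::real_normed_vector"
proof -
  have *: "((\<lambda>s. h (u + s)) has_vector_derivative d) (at v)"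
    if "(h has_vector_derivative d) (at (u + v))" for h :: "real \<Rightarrow> 'b" and u v
  proof -
    have "((\<lambda>s. u + s) has_vector_derivative 1) (at v)"
      by (auto intro!: derivative_eq_intros)
    from vector_diff_chain_at[OF this, of h d] that show ?thesis by (simp add: o_def)
  qed
  show ?thesis using *[of g t 0] *[of "\<lambda>s. g (t + s)" "- t" t] by auto
qed

lemma H_op_on_line:
  "H_op \<psi> (x + t *\<^sub>R \<xi>, \<xi>) = vderiv (\<lambda>t. \<psi> (x + t *\<^sub>R \<xi>, \<xi>)) t"
  using has_vector_derivative_translate_iff[of "\<lambda>t. \<psi> (x + t *\<^sub>R \<xi>, \<xi>)" t]
  by (simp add: H_op_def vector_derivative_def scaleR_add_left add.assoc)

lemma funpow_H_op_on_line:
  "(H_op ^^ j) \<psi> (x + t *\<^sub>R \<xi>, \<xi>) = (vderiv ^^ j) (\<lambda>t. \<psi> (x + t *\<^sub>R \<xi>, \<xi>)) t"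
  by (induction j arbitrary: t) (simp_all add: H_op_on_line)

lemma funpow_H_plus_on_line:
  "(H_plus \<alpha> ^^ j) \<psi> (x + t *\<^sub>R \<xi>, \<xi>) =
     (first_order_op (\<lambda>t. \<alpha> (x + t *\<^sub>R \<xi>, \<xi>)) ^^ j) (\<lambda>t. \<psi> (x + t *\<^sub>R \<xi>, \<xi>)) t"
  by (induction j arbitrary: t) (simp_all add: H_plus_def H_op_on_line first_order_op_def)

text \<open>By compactness of the closed segment, continuity up to the boundary makes all derivatives
  bounded on the open one; by the chain rule each derivative along the segment is a linear
  combination of partial derivatives.\<close>

lemma Ck_up_to_on_segment:
  fixes F :: "'a::euclidean_space \<Rightarrow> 'b::real_normed_vector"
  assumes "\<And>t. t \<in> {a<..<b} \<Longrightarrow> p + t *\<^sub>R v \<in> U" "\<And>t. t \<in> {a..b} \<Longrightarrow> p + t *\<^sub>R v \<in> V"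
    and "Ck_up_to m U V F"
  shows "bounded_derivs m {a<..<b} (\<lambda>t. F (p + t *\<^sub>R v))"
  using assms(3)
proof (induction m arbitrary: F)
  have bdd: "bounded ((\<lambda>t. F (p + t *\<^sub>R v)) ` {a<..<b})"
    if g: "continuous_on V g" "\<forall>q\<in>U. g q = F q" for g and F :: "'a \<Rightarrow> 'b"
  proof -
    have "continuous_on {a..b} (\<lambda>t. g (p + t *\<^sub>R v))"
      by (rule continuous_on_compose2[OF g(1)]) (auto intro!: continuous_intros assms(2))
    then have "bounded ((\<lambda>t. g (p + t *\<^sub>R v)) ` {a..b})"
      by (intro compact_imp_bounded compact_continuous_image) auto
    moreover have "(\<lambda>t. F (p + t *\<^sub>R v)) ` {a<..<b} \<subseteq> (\<lambda>t. g (p + t *\<^sub>R v)) ` {a..b}"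
    proof (rule image_subsetI)
      fix t assume t: "t \<in> {a<..<b}"
      then have "F (p + t *\<^sub>R v) = g (p + t *\<^sub>R v)" using g(2) assms(1) by simp
      with t show "F (p + t *\<^sub>R v) \<in> (\<lambda>t. g (p + t *\<^sub>R v)) ` {a..b}" by auto
    qed
    ultimately show ?thesis by (rule bounded_subset)
  qed
  {
    case 0
    then show ?case using bdd by auto
  next
    case (Suc m)
    let ?f = "\<lambda>t. F (p + t *\<^sub>R v)"
    have d: "(?f has_vector_derivative
        (\<Sum>i\<in>Basis. (v \<bullet> i) *\<^sub>R frechet_derivative F (at (p + t *\<^sub>R v)) i)) (at t)"
      if t: "t \<in> {a<..<b}" for t
    proof -
      let ?F' = "frechet_derivative F (at (p + t *\<^sub>R v))"
      have F': "(F has_derivative ?F') (at (p + t *\<^sub>R v))"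
        using Suc.prems assms(1)[OF t] by (simp add: frechet_derivative_works)
      then have lin: "linear ?F'" by (rule has_derivative_linear)
      have "((\<lambda>t. p + t *\<^sub>R v) has_derivative (\<lambda>h. h *\<^sub>R v)) (at t)"
        by (auto intro!: derivative_eq_intros)
      from has_derivative_compose[OF this F']
      have "(?f has_derivative (\<lambda>h. ?F' (h *\<^sub>R v))) (at t)" .
      then have "(?f has_vector_derivative ?F' v) (at t)"
        by (simp add: has_vector_derivative_def linear_cmul[OF lin])
      moreover have "?F' v = (\<Sum>i\<in>Basis. (v \<bullet> i) *\<^sub>R ?F' i)"
        by (subst (1) euclidean_representation[symmetric, of v])
           (simp add: linear_sum[OF lin] linear_cmul[OF lin])
      ultimately show ?thesis by simp
    qed
    have "bounded_derivs m {a<..<b} (vderiv ?f)"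
    proof (rule bounded_derivs_cong[OF open_greaterThanLessThan])
      show "(\<Sum>i\<in>Basis. (v \<bullet> i) *\<^sub>R frechet_derivative F (at (p + t *\<^sub>R v)) i) = vderiv ?f t"
        if "t \<in> {a<..<b}" for t
        using vector_derivative_at[OF d[OF that]] by simp
      show "bounded_derivs m {a<..<b}
          (\<lambda>t. \<Sum>i\<in>Basis. (v \<bullet> i) *\<^sub>R frechet_derivative F (at (p + t *\<^sub>R v)) i)"
        using Suc.prems
        by (intro bounded_derivs_sum bounded_derivs_bounded_linear[OF _ bounded_linear_scaleR_right]
              Suc.IH[of "\<lambda>q. frechet_derivative F (at q) _"]) auto
    qed
    then show ?case using Suc.prems bdd differentiableI_vector[OF d] by auto
  }
qed

lemma Ck_SD_on_chord:
  fixes f :: "'a::euclidean_space \<times> 'a \<Rightarrow> 'b::real_normed_vector"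
  assumes "Ck_SD m D f" "norm \<xi> = 1"
    and "\<And>t. t \<in> {a<..<b} \<Longrightarrow> x + t *\<^sub>R \<xi> \<in> D" "\<And>t. t \<in> {a..b} \<Longrightarrow> x + t *\<^sub>R \<xi> \<in> closure D"
  shows "bounded_derivs m {a<..<b} (\<lambda>t. f (x + t *\<^sub>R \<xi>, \<xi>))"
proof -
  have "\<xi> \<noteq> 0" "sgn \<xi> = \<xi>" using assms(2) by (auto simp: sgn_div_norm)
  then show ?thesis
    using Ck_up_to_on_segment[OF _ _ assms(1)[unfolded Ck_SD_def], of a b "(x, \<xi>)" "(\<xi>, 0)"]
      assms(3,4) by simp
qed

section \<open>The entry point of a chord\<close>

text \<open>A defining function \<open>r\<close> is negative on the open segment from the boundary point \<open>y\<close> to any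
  point of \<open>D\<close>, so its gradient \<open>g\<close> at \<open>y\<close> satisfies \<open>g \<bullet> (z - y) \<le> 0\<close> for every \<open>z \<in> D\<close>.
  If equality held at some \<open>z \<in> D\<close>, the inequality would fail at the
  points of \<open>D\<close> obtained by moving \<open>z\<close> a little along \<open>g\<close>.\<close>

lemma outer_normal_inner_neg:
  fixes D :: "'a::euclidean_space set"
  assumes "open D" "convex D" "y \<in> frontier D" "outer_normal D y \<nu>" "x \<in> D"
  shows "\<nu> \<bullet> (x - y) < 0"
proof -
  obtain U r g where r: "local_defining_function D y U r" "GDERIV r y :> g" and \<nu>: "\<nu> = sgn g"
    using assms(4) by (auto simp: outer_normal_def)
  have U: "open U" "y \<in> U" "D \<inter> U = {z \<in> U. r z < 0}" "frontier D \<inter> U = {z \<in> U. r z = 0}"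
    "frechet_derivative r (at y) \<noteq> (\<lambda>h. 0)"
    using r(1) assms(3) by (auto simp: local_defining_function_def)
  have dr: "(r has_derivative (\<lambda>h. h \<bullet> g)) (at y)"
    using r(2) by (simp add: gderiv_def)
  have "g \<noteq> 0" using U(5) frechet_derivative_at[OF dr] by auto
  have ry: "r y = 0" using U assms(3) by blast
  have le: "g \<bullet> (z - y) \<le> 0" if "z \<in> D" for z
  proof -
    let ?c = "\<lambda>t::real. y + t *\<^sub>R (z - y)"
    have "(?c has_derivative (\<lambda>h. h *\<^sub>R (z - y))) (at 0)"
      by (auto intro!: derivative_eq_intros)
    from has_derivative_compose[OF this, of r "\<lambda>h. h \<bullet> g"] dr
    have "((\<lambda>t. r (?c t)) has_derivative (\<lambda>h. (h *\<^sub>R (z - y)) \<bullet> g)) (at 0)" by simp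
    then have D0: "((\<lambda>t. r (?c t)) has_real_derivative (g \<bullet> (z - y))) (at 0)"
      by (simp add: has_field_derivative_def inner_commute mult.commute[of _ "g \<bullet> (z - y)"])
    have "(?c \<longlongrightarrow> y + 0 *\<^sub>R (z - y)) (at_right 0)"
      by (intro tendsto_intros)
    then have "eventually (\<lambda>t. ?c t \<in> U) (at_right 0)"
      using U(1,2) by (auto elim: topological_tendstoD)
    moreover have "?c t \<in> D" if t: "t \<in> {0<..<1}" for t
    proof -
      have "y - t *\<^sub>R (y - z) \<in> interior D"
        using mem_interior_closure_convex_shrink[of D z y t] assms(1,2,3) that \<open>z \<in> D\<close>
        by (auto simp: frontier_def interior_open)
      then show ?thesis
        using assms(1) by (simp add: interior_open algebra_simps)
    qed
    then have "eventually (\<lambda>t. ?c t \<in> D) (at_right 0)"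
      using eventually_at_right_real[of 0 1] by (auto elim: eventually_mono)
    ultimately have "eventually (\<lambda>t. r (?c t) / t \<le> 0) (at_right 0)"
      using eventually_at_right_less[of "0::real"]
    proof eventually_elim
      case (elim t)
      then have "r (?c t) < 0" using U(3) by blast
      with elim show ?case by (simp add: divide_nonpos_pos)
    qed
    moreover have "((\<lambda>t. r (?c t) / t) \<longlongrightarrow> g \<bullet> (z - y)) (at_right 0)"
      using D0 ry by (auto simp: has_field_derivative_iff intro: tendsto_mono[OF at_le])
    ultimately show ?thesis
      by (intro tendsto_upperbound[of "\<lambda>t. r (?c t) / t" _ "at_right 0"]) auto
  qed
  obtain e where e: "e > 0" "cball x e \<subseteq> D"
    using assms(1,5) open_contains_cball by blast
  have "x + e *\<^sub>R sgn g \<in> D"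
    using e \<open>g \<noteq> 0\<close> by (intro subsetD[OF e(2)]) (simp add: dist_norm norm_sgn)
  from le[OF this] have "g \<bullet> (x - y) + e * (g \<bullet> sgn g) \<le> 0"
    by (simp add: algebra_simps inner_simps)
  moreover have "e * (g \<bullet> sgn g) > 0"
    using e \<open>g \<noteq> 0\<close> by (simp add: sgn_div_norm)
  ultimately have "g \<bullet> (x - y) < 0" by linarith
  then show ?thesis
    using \<open>g \<noteq> 0\<close> by (simp add: \<nu> sgn_div_norm mult_pos_neg)
qed

text \<open>The chord is followed from its entry point to slightly beyond \<open>x\<close>: vanishing propagates
  forwards from the entry, so the rest of the chord has no influence at \<open>x\<close>.\<close>

lemma chord_entry:
  fixes D :: "'a::euclidean_space set"
  assumes "open D" "bounded D" "convex D" "x \<in> D" "norm \<xi> = 1"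
  obtains a b where "a < 0" "0 < b" "x + a *\<^sub>R \<xi> \<in> frontier D"
    "\<And>t. t \<in> {a<..<b} \<Longrightarrow> x + t *\<^sub>R \<xi> \<in> D" "\<And>t. t \<in> {a..b} \<Longrightarrow> x + t *\<^sub>R \<xi> \<in> closure D"
proof -
  have "- \<xi> \<noteq> 0" "x \<in> interior D" using assms by (auto simp: interior_open)
  then obtain d where d: "0 < d" "x + d *\<^sub>R (- \<xi>) \<in> frontier D"
    "\<And>e. 0 \<le> e \<Longrightarrow> e < d \<Longrightarrow> x + e *\<^sub>R (- \<xi>) \<in> interior D"
    using ray_to_frontier[OF assms(2)] by blast
  obtain e where e: "e > 0" "cball x e \<subseteq> D"
    using assms(1,4) open_contains_cball by blast
  have "x + t *\<^sub>R \<xi> \<in> D" if "t \<in> {- d<..e}" for t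
  proof (cases "t \<le> 0")
    case True
    then show ?thesis using d(3)[of "- t"] that interior_subset[of D] by auto
  next
    case False
    then show ?thesis using that e assms(5) by (intro subsetD[OF e(2)]) (simp add: dist_norm)
  qed
  moreover from this have "x + t *\<^sub>R \<xi> \<in> closure D" if "t \<in> {- d..e}" for t
    using that d(2) closure_subset[of D] by (cases "t = - d") (auto simp: frontier_def)
  ultimately show ?thesis using d e that[of "- d" e] by auto
qed

lemma boundary_value_on_chord:
  assumes "has_boundary_value D \<psi> (x + a *\<^sub>R \<xi>, \<xi>) c" "a < b" "norm \<xi> = 1"
    and "\<And>t. t \<in> {a<..<b} \<Longrightarrow> x + t *\<^sub>R \<xi> \<in> D"
  shows "((\<lambda>t. \<psi> (x + t *\<^sub>R \<xi>, \<xi>)) \<longlongrightarrow> c) (at_right a)"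
proof (rule filterlim_compose[of \<psi>])
  show "(\<psi> \<longlongrightarrow> c) (at (x + a *\<^sub>R \<xi>, \<xi>) within SD D)"
    using assms(1) by (simp add: has_boundary_value_def)
  have "eventually (\<lambda>t. (x + t *\<^sub>R \<xi>, \<xi>) \<in> SD D \<and> (x + t *\<^sub>R \<xi>, \<xi>) \<noteq> (x + a *\<^sub>R \<xi>, \<xi>)) (at_right a)"
    using eventually_at_right_real[OF assms(2)]
    by eventually_elim (use assms(3,4) in \<open>auto simp: SD_def\<close>)
  moreover have "((\<lambda>t. (x + t *\<^sub>R \<xi>, \<xi>)) \<longlongrightarrow> (x + a *\<^sub>R \<xi>, \<xi>)) (at_right a)"
    by (intro tendsto_intros)
  ultimately show "filterlim (\<lambda>t. (x + t *\<^sub>R \<xi>, \<xi>)) (at (x + a *\<^sub>R \<xi>, \<xi>) within SD D) (at_right a)"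
    by (simp add: filterlim_at eventually_conj_iff)
qed

section \<open>Uniqueness for the iterated transport equation\<close>

theorem theorem3p1:
  fixes D :: "(real^3) set"
    and n :: "real^3 \<Rightarrow> real^3"
    and k :: nat
    and \<epsilon> \<rho> :: "(real^3) \<times> (real^3) \<Rightarrow> real"
    and \<alpha> \<phi> :: "(real^3) \<times> (real^3) \<Rightarrow> complex"
  assumes "open D" and "connected D" and "D \<noteq> {}" and "bounded D" and "convex D"
    and "smooth_boundary D"
    and "\<And>x. x \<in> frontier D \<Longrightarrow> outer_normal D x (n x)"
    and "Ck_SD k D \<epsilon>" and "Ck_SD k D \<rho>"
    and "bounded (\<epsilon> ` SD D)" and "bounded (\<rho> ` SD D)"
    and "\<And>p. p \<in> SD D \<Longrightarrow> \<epsilon> p \<ge> 0"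
    and "\<alpha> = (\<lambda>p. complex_of_real (\<epsilon> p) + \<i> * complex_of_real (\<rho> p))"
    and "Ck_SD (k + 1) D \<phi>"
    and "\<And>p. p \<in> SD D \<Longrightarrow> 1 / fact k * (H_plus \<alpha> ^^ (k + 1)) \<phi> p = 0"
    and "\<And>x \<xi> j. x \<in> frontier D \<Longrightarrow> \<xi> \<in> sphere 0 1 \<Longrightarrow> n x \<bullet> \<xi> < 0 \<Longrightarrow> j \<le> k \<Longrightarrow>
           has_boundary_value D ((H_op ^^ j) \<phi>) (x, \<xi>) 0"
  shows "\<forall>p \<in> SD D. \<phi> p = 0"
proof (clarify)
  fix x \<xi> :: "real^3"
  assume "(x, \<xi>) \<in> SD D"
  then have x: "x \<in> D" and \<xi>: "norm \<xi> = 1" by (auto simp: SD_def)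
  obtain a b where ab: "a < 0" "0 < b" and entry: "x + a *\<^sub>R \<xi> \<in> frontier D"
    and inD: "\<And>t. t \<in> {a<..<b} \<Longrightarrow> x + t *\<^sub>R \<xi> \<in> D"
    and incl: "\<And>t. t \<in> {a..b} \<Longrightarrow> x + t *\<^sub>R \<xi> \<in> closure D"
    using chord_entry[OF assms(1,4,5) x \<xi>] by blast
  then have "a < b" by simp
  have inSD: "(x + t *\<^sub>R \<xi>, \<xi>) \<in> SD D" if "t \<in> {a<..<b}" for t
    using inD[OF that] \<xi> by (simp add: SD_def)
  let ?f = "\<lambda>t. \<phi> (x + t *\<^sub>R \<xi>, \<xi>)" and ?A = "\<lambda>t. \<alpha> (x + t *\<^sub>R \<xi>, \<xi>)"
  \<comment> \<open>From the entry point to \<open>x\<close> the displacement is \<open>- a\<xi>\<close>, and \<open>- a > 0\<close>.\<close>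
  have "n (x + a *\<^sub>R \<xi>) \<bullet> (- a *\<^sub>R \<xi>) < 0"
    using outer_normal_inner_neg[OF assms(1,5) entry assms(7)[OF entry] x] by simp
  then have "n (x + a *\<^sub>R \<xi>) \<bullet> \<xi> < 0"
    using ab(1) by (simp add: mult_less_0_iff zero_less_mult_iff)
  then have "((vderiv ^^ j) ?f \<longlongrightarrow> 0) (at_right a)" if "j \<le> k" for j
    using boundary_value_on_chord[OF assms(16)[OF entry _ _ that] \<open>a < b\<close> \<xi> inD] \<xi>
    by (simp add: funpow_H_op_on_line)
  then have flat: "flat_at (Suc k) a b ?f"
    using Ck_SD_on_chord[OF assms(14) \<xi> inD incl] by (intro flat_atI) auto
  have A: "bounded_derivs k {a<..<b} ?A"
    unfolding assms(13)
    by (intro bounded_derivs_add bounded_derivs_bounded_linear[OF _ bounded_linear_of_real]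
          bounded_derivs_bounded_linear[OF _ bounded_linear_mult_right]
          Ck_SD_on_chord[OF assms(8) \<xi> inD incl] Ck_SD_on_chord[OF assms(9) \<xi> inD incl]
          open_greaterThanLessThan)
  have "?f 0 = 0"
  proof (rule funpow_first_order_op_unique[OF \<open>a < b\<close> _ A flat])
    show "0 \<le> Re (?A t)" if "t \<in> {a<..<b}" for t
      using assms(12)[OF inSD[OF that]] by (simp add: assms(13))
    show "(first_order_op ?A ^^ Suc k) ?f t = 0" if "t \<in> {a<..<b}" for t
      using assms(15)[OF inSD[OF that]] by (simp only: funpow_H_plus_on_line) simp
    show "0 \<in> {a<..<b}" using ab by simp
  qed
  then show "\<phi> (x, \<xi>) = 0" by simp
qed

end
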